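(* Let $k\ge 1$ and let $a_i,b_i,c_i$ ($i=1,\dots,k$) be non-negative integers such that $\sum_{i=1}^k c_i(a_i-b_i)=0$. For an image intensity function $g$ on $\mathbb{R}^2$ with centroid $(x_c,y_c)$ and non-negative integers $a,b$, put $$C_{ab}(g)=\int_{-\infty}^{\infty}\int_{-\infty}^{\infty}\big[(x-x_c)+j(y-y_c)\big]^a\big[(x-x_c)-j(y-y_c)\big]^b\,g(x,y)\,dx\,dy ,$$ where $j$ is the imaginary unit. Then the quantity $$\Phi(g)=\prod_{i=1}^k \frac{C_{a_ib_i}(g)^{c_i}}{C_{00}(g)^{w_i}},\qquad w_i=c_i\,\frac{a_i+b_i+2}{2},$$ is invariant under translation, rotation and uniform scaling (TRS). That is, for every map $T:\mathbb{R}^2\to\mathbb{R}^2$ that is a translation, a rotation about the origin, a uniform scaling $(x,y)\mapsto(\alpha x,\alpha y)$ with $\alpha>0$, or a composition of such maps, and every image intensity function $g$, the transformed image $g'=g\circ T^{-1}$ satisfies $\Phi(g')=\Phi(g)$.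
   Context: An image intensity function is a measurable, bounded, compactly supported function $g:\mathbb{R}^2\to[0,\infty)$ with $\iint g\,dx\,dy>0$. Its geometric moments are $\mu_{ab}=\iint x^a y^b g(x,y)\,dx\,dy$, and its centroid is $(x_c,y_c)=(\mu_{10}/\mu_{00},\ \mu_{01}/\mu_{00})$. The centroid used in $C_{ab}(g')$ is the centroid of $g'$. If $(x',y')=T(x,y)$ is a geometric transformation of the plane, the transformed image $g'$ is defined by $g'(x',y')=g(x,y)$, i.e. $g'=g\circ T^{-1}$. Since $C_{00}(g)=\mu_{00}>0$, the (possibly half-integer) power $C_{00}(g)^{w_i}$ is the positive real power. The convention $z^0=1$ for every complex $z$ (including $z=0$) is used. *)

theory Defs
  imports "HOL-Analysis.Analysis"
begin

definition image_intensity :: "(real^2 \<Rightarrow> real) \<Rightarrow> bool" where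
  "image_intensity g \<longleftrightarrow>
     g \<in> borel_measurable lebesgue \<and> (\<forall>p. 0 \<le> g p) \<and> bounded (range g) \<and>
     compact (closure {p. g p \<noteq> 0}) \<and> (LINT p|lebesgue. g p) > 0"

definition geometric_moment :: "(real^2 \<Rightarrow> real) \<Rightarrow> nat \<Rightarrow> nat \<Rightarrow> real" where
  "geometric_moment g a b = (LINT p|lebesgue. (p$1) ^ a * (p$2) ^ b * g p)"

definition centroid_x :: "(real^2 \<Rightarrow> real) \<Rightarrow> real" where
  "centroid_x g = geometric_moment g 1 0 / geometric_moment g 0 0"

definition centroid_y :: "(real^2 \<Rightarrow> real) \<Rightarrow> real" where
  "centroid_y g = geometric_moment g 0 1 / geometric_moment g 0 0"

definition complex_moment :: "(real^2 \<Rightarrow> real) \<Rightarrow> nat \<Rightarrow> nat \<Rightarrow> complex" where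
  "complex_moment g a b =
     (LINT p|lebesgue.
        (of_real (p$1 - centroid_x g) + \<i> * of_real (p$2 - centroid_y g)) ^ a *
        (of_real (p$1 - centroid_x g) - \<i> * of_real (p$2 - centroid_y g)) ^ b *
        of_real (g p))"

text \<open>
  The denominator of \<open>moment_invariant\<close> uses the complex \<open>powr\<close>. Its base \<open>complex_moment g 0 0\<close>
  is a positive real for an image intensity function, so this is the positive real power:
  see \<open>complex_moment_0_0_powr\<close> below.
\<close>

definition moment_invariant ::
  "nat \<Rightarrow> (nat \<Rightarrow> nat) \<Rightarrow> (nat \<Rightarrow> nat) \<Rightarrow> (nat \<Rightarrow> nat) \<Rightarrow> (real^2 \<Rightarrow> real) \<Rightarrow> complex" where
  "moment_invariant k a b c g =
     (\<Prod>i=1..k. complex_moment g (a i) (b i) ^ c i /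
        complex_moment g 0 0 powr of_real (real (c i) * (real (a i) + real (b i) + 2) / 2))"

lemma complex_moment_0_0: "complex_moment g 0 0 = of_real (geometric_moment g 0 0)"
  by (simp add: complex_moment_def geometric_moment_def)

lemma complex_moment_0_0_powr:
  assumes "image_intensity g"
  shows "complex_moment g 0 0 powr of_real w = of_real (geometric_moment g 0 0 powr w)"
    and "geometric_moment g 0 0 > 0"
proof -
  show pos: "geometric_moment g 0 0 > 0"
    using assms by (simp add: image_intensity_def geometric_moment_def)
  show "complex_moment g 0 0 powr of_real w = of_real (geometric_moment g 0 0 powr w)"
    using pos by (simp add: complex_moment_0_0 powr_of_real)
qed

definition plane_rotation :: "real \<Rightarrow> real^2 \<Rightarrow> real^2" where
  "plane_rotation \<theta> p =
     vector [cos \<theta> * p$1 - sin \<theta> * p$2, sin \<theta> * p$1 + cos \<theta> * p$2]"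

inductive TRS_map :: "(real^2 \<Rightarrow> real^2) \<Rightarrow> bool" where
  translation: "TRS_map (\<lambda>p. t + p)"
| rotation: "TRS_map (plane_rotation \<theta>)"
| scaling: "\<alpha> > 0 \<Longrightarrow> TRS_map (\<lambda>p. \<alpha> *\<^sub>R p)"
| composition: "TRS_map S \<Longrightarrow> TRS_map T \<Longrightarrow> TRS_map (S \<circ> T)"

text \<open>
  The transformed image uses the total inverse \<open>inv\<close>, which is only meaningful for bijections;
  every TRS map is one.
\<close>

lemma bij_plane_rotation: "bij (plane_rotation \<theta>)"
proof (rule o_bij)
  have *: "plane_rotation (- \<theta>) (plane_rotation \<theta> p) = p" for \<theta> p
  proof -
    have "cos \<theta> * cos \<theta> + sin \<theta> * sin \<theta> = 1"
      using sin_cos_squared_add3 [of \<theta>] .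
    then have "cos \<theta> * (cos \<theta> * u) + sin \<theta> * (sin \<theta> * u) = u" for u
      by (metis distrib_right mult.assoc mult_1)
    then show ?thesis
      by (simp add: plane_rotation_def vec_eq_iff forall_2 right_diff_distrib distrib_left
          mult.left_commute add.commute)
  qed
  show "plane_rotation (- \<theta>) \<circ> plane_rotation \<theta> = id"
    by (simp add: fun_eq_iff *)
  show "plane_rotation \<theta> \<circ> plane_rotation (- \<theta>) = id"
    using *[of "- \<theta>"] by (simp add: fun_eq_iff)
qed

lemma TRS_map_imp_bij: "TRS_map T \<Longrightarrow> bij T"
proof (induction rule: TRS_map.induct)
  case (translation t)
  show ?case
    by (intro o_bij [of "\<lambda>p. p - t"]) (auto simp: fun_eq_iff)
next
  case (rotation \<theta>)
  show ?case by (rule bij_plane_rotation)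
next
  case (scaling \<alpha>)
  then show ?case
    by (intro o_bij [of "\<lambda>p. inverse \<alpha> *\<^sub>R p"]) (auto simp: fun_eq_iff)
next
  case (composition S T)
  then show ?case by (blast intro: bij_comp)
qed

definition transformed_image ::
  "(real^2 \<Rightarrow> real^2) \<Rightarrow> (real^2 \<Rightarrow> real) \<Rightarrow> real^2 \<Rightarrow> real" where
  "transformed_image T g = g \<circ> inv T"

end

theory Submission
  imports Defs
begin

text \<open>
  Identify the plane with the complex numbers. A TRS map is then an affine map
  \<open>z \<mapsto> m * z + t\<close> with \<open>m \<noteq> 0\<close> and Jacobian \<open>(cmod m)\<^sup>2\<close>, and it carries the centroid of \<open>g\<close> to
  that of the transformed image. Substituting in the integral multiplies the moment of order
  \<open>(a, b)\<close> by \<open>(cmod m)\<^sup>2 * m ^ a * cnj m ^ b\<close>. Writing \<open>m = cmod m * u\<close>, the modulus cancels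
  against the power of the zeroth moment, and what remains is \<open>u\<close> to the power
  \<open>\<Sum>i. c i * (a i - b i) = 0\<close>.
\<close>

section \<open>Complex coordinates for TRS maps\<close>

definition to_complex :: "real^2 \<Rightarrow> complex" where
  "to_complex p = Complex (p$1) (p$2)"

lemma Re_to_complex [simp]: "Re (to_complex p) = p$1"
  and Im_to_complex [simp]: "Im (to_complex p) = p$2"
  by (simp_all add: to_complex_def)

lemma continuous_on_to_complex [continuous_intros]: "continuous_on A to_complex"
  unfolding to_complex_def Complex_eq by (intro continuous_intros)

text \<open>The maps \<open>z \<mapsto> m * z + t\<close> with \<open>m \<noteq> 0\<close> are
  closed under composition, and the three generators are of this form, with \<open>m\<close> equal
  to 1, \<open>cis \<theta>\<close> and \<alpha>.\<close>

lemma TRS_map_similarity: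
  assumes "TRS_map T"
  obtains m t where "m \<noteq> 0" "\<And>p. to_complex (T p) = m * to_complex p + t"
proof -
  have "\<exists>m t. m \<noteq> 0 \<and> (\<forall>p. to_complex (T p) = m * to_complex p + t)"
    using assms
  proof induction
    case (translation t)
    show ?case
      by (intro exI[of _ 1] exI[of _ "to_complex t"]) (simp add: complex_eq_iff)
  next
    case (rotation \<theta>)
    show ?case
      by (intro exI[of _ "cis \<theta>"] exI[of _ 0] conjI allI cis_neq_zero)
        (simp add: complex_eq_iff plane_rotation_def)
  next
    case (scaling \<alpha>)
    then show ?case
      by (intro exI[of _ "of_real \<alpha>"] exI[of _ 0]) (simp add: complex_eq_iff)
  next
    case (composition S T)
    then obtain m t m' t' where *: "m \<noteq> 0" "\<And>p. to_complex (S p) = m * to_complex p + t"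
      "m' \<noteq> 0" "\<And>p. to_complex (T p) = m' * to_complex p + t'"
      by blast
    show ?case
      by (intro exI[of _ "m * m'"] exI[of _ "m * t' + t"]) (simp add: * algebra_simps)
  qed
  then show ?thesis
    using that by blast
qed

section \<open>Change of variables and integrability\<close>

text \<open>Transfers \<open>has_absolute_integral_change_of_variables\<close> from the
  Henstock-Kurzweil integral to the Lebesgue integral, one coordinate of \<open>f\<close> at a time.
  Integrability is assumed on the pulled-back side, because that is where the original image
  appears.\<close>

lemma lebesgue_integral_change_of_variables:
  fixes f :: "real^'n::{finite,wellorder} \<Rightarrow> 'b::euclidean_space"
  assumes der: "\<And>x. (T has_derivative T' x) (at x)" and "bij T"
    and int: "integrable lebesgue (\<lambda>x. \<bar>det (matrix (T' x))\<bar> *\<^sub>R f (T x))"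
  shows "integrable lebesgue f"
    and "(LINT x|lebesgue. f x) = (LINT x|lebesgue. \<bar>det (matrix (T' x))\<bar> *\<^sub>R f (T x))"
proof -
  let ?J = "\<lambda>x. \<bar>det (matrix (T' x))\<bar>"
  have component: "integrable lebesgue (\<lambda>x. f x \<bullet> i) \<and>
      (LINT x|lebesgue. f x \<bullet> i) = (LINT x|lebesgue. ?J x *\<^sub>R f (T x)) \<bullet> i" for i
  proof -
    \<comment> \<open>The theorem to be applied concerns functions into a space
      \<open>real^'n\<close>, so the scalar coordinate is wrapped as a vector of length one.\<close>
    define F :: "real^'n::_ \<Rightarrow> real^1" where "F x = vec (f x \<bullet> i)" for x
    have FJ: "?J x *\<^sub>R F (T x) = vec ((?J x *\<^sub>R f (T x)) \<bullet> i)" for x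
      by (simp add: F_def vec_eq_iff)
    have vec_bl: "bounded_linear (vec :: real \<Rightarrow> real^1)"
      by (simp add: linear_conv_bounded_linear [symmetric] linear_iff vec_eq_iff)
    have intJ: "integrable lebesgue (\<lambda>x. (?J x *\<^sub>R f (T x)) \<bullet> i)"
      using int by (rule integrable_inner_left)
    have intFJ: "integrable lebesgue (\<lambda>x. ?J x *\<^sub>R F (T x))"
      unfolding FJ using vec_bl intJ by (rule integrable_bounded_linear)
    have "F absolutely_integrable_on range T \<and>
        integral (range T) F = integral UNIV (\<lambda>x. ?J x *\<^sub>R F (T x))"
    proof (rule has_absolute_integral_change_of_variables [THEN iffD1])
      show "(T has_derivative T' x) (at x within UNIV)" for x
        using der by simp
      show "inj T"
        using \<open>bij T\<close> by (rule bij_is_inj)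
    qed (use intFJ in \<open>auto simp: set_integrable_def\<close>)
    then have intF: "integrable lebesgue F" and
      eq: "integral UNIV F = integral UNIV (\<lambda>x. ?J x *\<^sub>R F (T x))"
      using \<open>bij T\<close> by (auto simp: set_integrable_def bij_is_surj)
    have intf: "integrable lebesgue (\<lambda>x. f x \<bullet> i)"
      using integrable_bounded_linear [OF bounded_linear_vec_nth [of 1] intF] by (simp add: F_def)
    have "vec (LINT x|lebesgue. f x \<bullet> i) = (LINT x|lebesgue. F x)"
      unfolding F_def using integral_bounded_linear [OF vec_bl intf] by simp
    \<comment> \<open>The two notions of integral agree on Lebesgue integrable functions.\<close>
    also have "\<dots> = (LINT x|lebesgue. ?J x *\<^sub>R F (T x))"
      using eq by (simp only: integral_lebesgue [OF intF] integral_lebesgue [OF intFJ])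
    also have "\<dots> = vec (LINT x|lebesgue. (?J x *\<^sub>R f (T x)) \<bullet> i)"
      unfolding FJ by (rule integral_bounded_linear [OF vec_bl intJ])
    also have "(LINT x|lebesgue. (?J x *\<^sub>R f (T x)) \<bullet> i) = (LINT x|lebesgue. ?J x *\<^sub>R f (T x)) \<bullet> i"
      by (rule integral_inner_left) (use int in auto)
    finally show ?thesis
      using intf by (simp add: vec_eq_iff)
  qed
  \<comment> \<open>\<open>f\<close> is the sum of its coordinates along the basis. Its
    integrability comes first because taking \<open>\<bullet> i\<close> out of the integral relies
    on it.\<close>
  have "integrable lebesgue (\<lambda>x. \<Sum>i\<in>Basis. (f x \<bullet> i) *\<^sub>R i)"
    using component by (intro Bochner_Integration.integrable_sum integrable_scaleR_left) auto
  then show intf: "integrable lebesgue f"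
    by (simp add: euclidean_representation)
  show "(LINT x|lebesgue. f x) = (LINT x|lebesgue. ?J x *\<^sub>R f (T x))"
  proof (rule euclidean_eqI)
    fix i
    have "(LINT x|lebesgue. f x) \<bullet> i = (LINT x|lebesgue. f x \<bullet> i)"
      by (rule integral_inner_left [symmetric]) (use intf in auto)
    then show "(LINT x|lebesgue. f x) \<bullet> i = (LINT x|lebesgue. ?J x *\<^sub>R f (T x)) \<bullet> i"
      using component by simp
  qed
qed

text \<open>Multiplication by \<open>m\<close> has the real matrix with rows
  \<open>(Re m, - Im m)\<close> and \<open>(Im m, Re m)\<close>, whose determinant is
  \<open>(cmod m)\<^sup>2\<close>. This Jacobian is constant and leaves the integral.\<close>

lemma lebesgue_integral_similarity:
  fixes f :: "real^2 \<Rightarrow> 'b::euclidean_space"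
  assumes T: "\<And>p. to_complex (T p) = m * to_complex p + t" and "bij T"
    and int: "integrable lebesgue (\<lambda>p. f (T p))"
  shows "integrable lebesgue f"
    and "(LINT p|lebesgue. f p) = (cmod m)\<^sup>2 *\<^sub>R (LINT p|lebesgue. f (T p))"
proof -
  define L :: "real^2 \<Rightarrow> real^2" where
    "L p = vector [Re m * p$1 - Im m * p$2, Im m * p$1 + Re m * p$2]" for p
  have T_eq: "T p = L p + vector [Re t, Im t]" for p
    using arg_cong [OF T [of p], of Re] arg_cong [OF T [of p], of Im]
    by (simp add: L_def vec_eq_iff forall_2)
  have "linear L"
    by (simp add: L_def linear_iff vec_eq_iff forall_2 algebra_simps)
  then have der: "(T has_derivative L) (at p)" for p
    unfolding T_eq [abs_def] by (auto intro!: derivative_eq_intros linear_imp_has_derivative)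
  have det: "\<bar>det (matrix L)\<bar> = (cmod m)\<^sup>2"
    by (simp add: det_2 matrix_def L_def axis_def cmod_power2)
      (simp add: power2_eq_square)
  show "integrable lebesgue f"
    using lebesgue_integral_change_of_variables(1) [OF der \<open>bij T\<close>, of f] int by (simp add: det)
  show "(LINT p|lebesgue. f p) = (cmod m)\<^sup>2 *\<^sub>R (LINT p|lebesgue. f (T p))"
    using lebesgue_integral_change_of_variables(2) [OF der \<open>bij T\<close>, of f] int by (simp add: det)
qed

text \<open>On the compact support both \<open>h\<close> and \<open>g\<close> are bounded; outside
  it the product vanishes. Polynomial weights \<open>h\<close> give the moments.\<close>

lemma image_intensity_integrable:
  fixes h :: "real^2 \<Rightarrow> complex"
  assumes g: "image_intensity g" and h: "continuous_on UNIV h"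
  shows "integrable lebesgue (\<lambda>p. h p * of_real (g p))"
proof -
  let ?K = "closure {p. g p \<noteq> 0}"
  have K: "compact ?K" and g_meas [measurable]: "g \<in> borel_measurable lebesgue"
    using g by (auto simp: image_intensity_def)
  have h_meas [measurable]: "h \<in> borel_measurable lebesgue"
    using h by (intro measurable_completion) (simp add: borel_measurable_continuous_onI)
  have "bounded (range g)"
    using g by (simp add: image_intensity_def)
  then obtain B where B: "\<And>p. \<bar>g p\<bar> \<le> B"
    unfolding bounded_iff real_norm_def by blast
  have "compact (h ` ?K)"
    using h K by (blast intro: compact_continuous_image continuous_on_subset)
  then obtain H where H: "\<And>p. p \<in> ?K \<Longrightarrow> cmod (h p) \<le> H"
    by (meson bounded_iff compact_imp_bounded imageI)
  show ?thesis
  proof (rule integrableI_bounded_set [where A = ?K and B = "H * B"])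
    show "?K \<in> sets lebesgue" "emeasure lebesgue ?K < \<infinity>"
      using lmeasurable_compact [OF K] by (auto simp: fmeasurable_def)
    show "(\<lambda>p. h p * of_real (g p)) \<in> borel_measurable lebesgue"
      by measurable
    show "AE p in lebesgue. p \<in> ?K \<longrightarrow> norm (h p * complex_of_real (g p)) \<le> H * B"
      \<comment> \<open>\<open>mult_mono\<close> asks for \<open>0 \<le> H\<close>, which follows
        from the bound on \<open>cmod (h p)\<close> at the point \<open>p\<close> itself.\<close>
      using H B by (intro AE_I2 impI) (auto simp: norm_mult intro!: mult_mono order_trans [OF norm_ge_zero H])
    show "AE p in lebesgue. p \<notin> ?K \<longrightarrow> h p * complex_of_real (g p) = 0"
      using closure_subset [of "{p. g p \<noteq> 0}"] by (intro AE_I2) auto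
  qed
qed

section \<open>Centroid and moments of the transformed image\<close>

definition complex_centroid :: "(real^2 \<Rightarrow> real) \<Rightarrow> complex" where
  "complex_centroid g = Complex (centroid_x g) (centroid_y g)"

text \<open>The real and imaginary parts of the complex first moment are the two real first moments;
  integrability lets \<open>Re\<close> and \<open>Im\<close> pass through the integral.\<close>

lemma complex_centroid_eq:
  assumes "integrable lebesgue (\<lambda>p. to_complex p * of_real (g p))"
  shows "complex_centroid g =
    (LINT p|lebesgue. to_complex p * of_real (g p)) / (LINT p|lebesgue. of_real (g p))"
  using integral_Re [OF assms] integral_Im [OF assms]
  by (simp add: complex_eq_iff complex_centroid_def centroid_x_def centroid_y_def
      geometric_moment_def)

lemma complex_moment_eq:
  "complex_moment g a b = (LINT p|lebesgue.
     (to_complex p - complex_centroid g) ^ a * cnj (to_complex p - complex_centroid g) ^ b *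
     of_real (g p))"
proof -
  have "of_real (p$1 - centroid_x g) + \<i> * of_real (p$2 - centroid_y g) =
      to_complex p - complex_centroid g"
    "of_real (p$1 - centroid_x g) - \<i> * of_real (p$2 - centroid_y g) =
      cnj (to_complex p - complex_centroid g)" for p :: "real^2"
    by (simp_all add: complex_eq_iff complex_centroid_def)
  then show ?thesis
    by (simp add: complex_moment_def)
qed

text \<open>After the substitution \<open>T p\<close> for \<open>p\<close>, the transformed image is
  only evaluated at points \<open>T p\<close>, so \<open>inv\<close> disappears from the
  integrals.\<close>

lemma transformed_image_apply [simp]:
  "bij T \<Longrightarrow> transformed_image T g (T p) = g p"
  by (simp add: transformed_image_def bij_is_inj)

text \<open>The zeroth and first moments acquire the same Jacobian factor, which cancels in their
  quotient; linearity of the integral does the rest.\<close>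

lemma complex_centroid_transformed_image:
  assumes T: "\<And>p. to_complex (T p) = m * to_complex p + t" and "bij T" "m \<noteq> 0"
    and g: "image_intensity g"
  shows "complex_centroid (transformed_image T g) = m * complex_centroid g + t"
proof -
  let ?g' = "transformed_image T g"
  let ?M = "LINT p|lebesgue. complex_of_real (g p)"
  have int_z: "integrable lebesgue (\<lambda>p. to_complex p * of_real (g p))"
    and int_1: "integrable lebesgue (\<lambda>p. complex_of_real (g p))"
    using image_intensity_integrable [OF g, of to_complex] image_intensity_integrable [OF g, of "\<lambda>_. 1"]
    by (auto intro!: continuous_intros)
  have "?M \<noteq> 0"
    using g by (simp add: image_intensity_def)
  have Tp: "to_complex (T p) * of_real (?g' (T p)) =
      m * (to_complex p * of_real (g p)) + t * of_real (g p)" for p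
    using \<open>bij T\<close> by (simp add: T algebra_simps)
  have int_T: "integrable lebesgue (\<lambda>p. to_complex (T p) * of_real (?g' (T p)))"
    unfolding Tp using int_z int_1 by (intro Bochner_Integration.integrable_add integrable_mult_right) auto
  \<comment> \<open>Supplies both the value of the first moment of \<open>?g'\<close> and its
    integrability, which \<open>complex_centroid_eq\<close> requires.\<close>
  note z' = lebesgue_integral_similarity [OF T \<open>bij T\<close>, of "\<lambda>p. to_complex p * of_real (?g' p)", OF int_T]
  have "(LINT p|lebesgue. to_complex p * of_real (?g' p)) =
      (cmod m)\<^sup>2 *\<^sub>R (m * (LINT p|lebesgue. to_complex p * of_real (g p)) + t * ?M)"
    unfolding z'(2) Tp using int_z int_1 by simp
  moreover have "(LINT p|lebesgue. complex_of_real (?g' p)) = (cmod m)\<^sup>2 *\<^sub>R ?M"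
    using lebesgue_integral_similarity(2) [OF T \<open>bij T\<close>, of "\<lambda>p. complex_of_real (?g' p)"]
      int_1 \<open>bij T\<close> by simp
  ultimately show ?thesis
    using \<open>m \<noteq> 0\<close> \<open>?M \<noteq> 0\<close> unfolding complex_centroid_eq [OF z'(1)] complex_centroid_eq [OF int_z]
    by (simp add: scaleR_conv_of_real field_simps del: integral_complex_of_real)
qed

text \<open>Each of the \<open>a\<close> factors contributes \<open>m\<close>, each of the
  \<open>b\<close> conjugated factors contributes \<open>cnj m\<close>, and the Jacobian contributes
  \<open>(cmod m)\<^sup>2\<close>.\<close>

lemma complex_moment_transformed_image:
  assumes T: "\<And>p. to_complex (T p) = m * to_complex p + t" and "bij T" "m \<noteq> 0"
    and g: "image_intensity g"
  shows "complex_moment (transformed_image T g) a b =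
    of_real ((cmod m)\<^sup>2) * m ^ a * cnj m ^ b * complex_moment g a b"
proof -
  let ?g' = "transformed_image T g"
  define f where "f p = (to_complex p - complex_centroid ?g') ^ a *
    cnj (to_complex p - complex_centroid ?g') ^ b * of_real (?g' p)" for p
  let ?F = "\<lambda>p. (to_complex p - complex_centroid g) ^ a *
    cnj (to_complex p - complex_centroid g) ^ b * of_real (g p)"
  \<comment> \<open>The centroid moves along with the points, so \<open>t\<close> cancels.\<close>
  have "to_complex (T p) - complex_centroid ?g' = m * (to_complex p - complex_centroid g)" for p
    using complex_centroid_transformed_image [OF assms] by (simp add: T algebra_simps)
  then have fT: "f (T p) = m ^ a * cnj m ^ b * ?F p" for p
    using \<open>bij T\<close> by (simp add: f_def power_mult_distrib mult_ac del: complex_cnj_diff)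
  have int: "integrable lebesgue ?F"
    using g by (intro image_intensity_integrable) (auto intro!: continuous_intros)
  have "complex_moment ?g' a b = (LINT p|lebesgue. f p)"
    by (simp only: complex_moment_eq f_def)
  also have "\<dots> = (cmod m)\<^sup>2 *\<^sub>R (LINT p|lebesgue. f (T p))"
    using lebesgue_integral_similarity(2) [OF T \<open>bij T\<close>, of f] int by (simp only: fT integrable_mult_right)
  also have "(LINT p|lebesgue. f (T p)) = m ^ a * cnj m ^ b * complex_moment g a b"
    by (simp only: fT complex_moment_eq integral_mult_right_zero)
  finally show ?thesis
    by (simp add: scaleR_conv_of_real mult_ac)
qed

section \<open>Cancellation of the scale and of the phase\<close>

text \<open>The square in the base clears the half in the exponent. The right-hand side is grouped
  as the powers of \<open>r\<close> arise in the numerator of a factor.\<close>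

lemma powr_square_half_integer:
  assumes "r > (0::real)"
  shows "(r\<^sup>2) powr (real c * (real a + real b + 2) / 2) = (r\<^sup>2) ^ c * r ^ (c * a) * r ^ (c * b)"
proof -
  have "(r\<^sup>2) powr (real c * (real a + real b + 2) / 2) = r powr real (2 * c + c * a + c * b)"
    using assms by (simp add: powr_powr flip: powr_numeral) (simp add: algebra_simps)
  also have "\<dots> = r ^ (2 * c + c * a + c * b)"
    using assms by (rule powr_realpow)
  finally show ?thesis
    by (simp add: power_add power_mult)
qed

theorem theorem3p2p6:
  fixes k :: nat and a b c :: "nat \<Rightarrow> nat"
    and g :: "real^2 \<Rightarrow> real" and T :: "real^2 \<Rightarrow> real^2"
  assumes "k \<ge> 1"
    and "(\<Sum>i=1..k. int (c i) * (int (a i) - int (b i))) = 0"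
    and "TRS_map T"
    and "image_intensity g"
  shows "moment_invariant k a b c (transformed_image T g) = moment_invariant k a b c g"
proof -
  obtain m t where "m \<noteq> 0" and T: "\<And>p. to_complex (T p) = m * to_complex p + t"
    using TRS_map_similarity [OF \<open>TRS_map T\<close>] by blast
  note moment = complex_moment_transformed_image
    [OF T TRS_map_imp_bij [OF \<open>TRS_map T\<close>] \<open>m \<noteq> 0\<close> \<open>image_intensity g\<close>]
  let ?g' = "transformed_image T g"
  \<comment> \<open>Polar decomposition of \<open>m\<close>: \<open>r\<close> is the scale and
    \<open>u\<close> the phase, of modulus one.\<close>
  define r where "r = cmod m"
  define u where "u = m / of_real r"
  define M where "M = geometric_moment g 0 0"
  have "r > 0"
    using \<open>m \<noteq> 0\<close> by (simp add: r_def)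
  have m: "m = of_real r * u" "cnj m = of_real r * cnj u"
    using \<open>r > 0\<close> by (simp_all add: u_def)
  have "u * cnj u = 1"
    using \<open>r > 0\<close> by (simp add: u_def r_def complex_norm_square flip: complex_norm_square power2_eq_square)
  have "M > 0"
    using complex_moment_0_0_powr(2) \<open>image_intensity g\<close> by (simp add: M_def)
  have M: "complex_moment g 0 0 = of_real M" "complex_moment ?g' 0 0 = of_real (r\<^sup>2 * M)"
    using moment [of 0 0] complex_moment_0_0 [of g] by (simp_all add: M_def r_def)
  \<comment> \<open>Numerator and denominator both acquire the factor \<open>?R\<close>, so only
    powers of the phase survive.\<close>
  have factor: "complex_moment ?g' (a i) (b i) ^ c i /
        complex_moment ?g' 0 0 powr of_real (real (c i) * (real (a i) + real (b i) + 2) / 2) =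
      (u ^ (c i * a i) * cnj u ^ (c i * b i)) * (complex_moment g (a i) (b i) ^ c i /
        complex_moment g 0 0 powr of_real (real (c i) * (real (a i) + real (b i) + 2) / 2))" for i
  proof -
    let ?w = "real (c i) * (real (a i) + real (b i) + 2) / 2"
    let ?R = "(r\<^sup>2) ^ c i * r ^ (c i * a i) * r ^ (c i * b i)"
    \<comment> \<open>The power of the product is split over the positive reals, where
      \<open>powr\<close> is multiplicative, before returning to complex
      \<open>powr\<close>.\<close>
    have "complex_moment ?g' 0 0 powr of_real ?w = of_real ((r\<^sup>2 * M) powr ?w)"
      unfolding M using \<open>r > 0\<close> \<open>M > 0\<close> by (intro powr_of_real) auto
    also have "(r\<^sup>2 * M) powr ?w = ?R * M powr ?w"
      using \<open>r > 0\<close> \<open>M > 0\<close> by (simp only: powr_mult powr_square_half_integer)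
    also have "of_real (?R * M powr ?w) = of_real ?R * complex_moment g 0 0 powr of_real ?w"
      unfolding M using \<open>M > 0\<close> by (simp add: powr_of_real del: of_real_divide)
    finally have denominator: "complex_moment ?g' 0 0 powr of_real ?w =
      of_real ?R * complex_moment g 0 0 powr of_real ?w" .
    have numerator: "complex_moment ?g' (a i) (b i) ^ c i = of_real ?R *
        (u ^ (c i * a i) * cnj u ^ (c i * b i) * complex_moment g (a i) (b i) ^ c i)"
    proof -
      have "complex_moment ?g' (a i) (b i) =
          of_real (r\<^sup>2) * (of_real r * u) ^ a i * (of_real r * cnj u) ^ b i * complex_moment g (a i) (b i)"
        by (simp only: m [symmetric]) (simp only: moment r_def)
      then show ?thesis
        by (simp add: power_mult_distrib mult.commute [of "c i"] flip: power_mult)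
    qed
    have "complex_of_real ?R \<noteq> 0"
      using \<open>r > 0\<close> by simp
    then show ?thesis
      unfolding numerator denominator by (subst mult_divide_mult_cancel_left) (simp_all only: times_divide_eq_right not_False_eq_True)
  qed
  \<comment> \<open>The balance condition, read as equality of the total exponents of
    \<open>u\<close> and \<open>cnj u\<close>. It is a statement about differences, hence the detour
    through \<open>int\<close>.\<close>
  have "(\<Sum>i=1..k. c i * a i) = (\<Sum>i=1..k. c i * b i)"
  proof -
    have "int (\<Sum>i=1..k. c i * a i) = int (\<Sum>i=1..k. c i * b i)"
      using assms(2) by (simp add: right_diff_distrib sum_subtractf)
    then show ?thesis
      by (simp only: of_nat_eq_iff)
  qed
  \<comment> \<open>Equal exponents merge the phases into a power of \<open>u * cnj u\<close>, which
    is 1.\<close>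
  then have "(\<Prod>i=1..k. u ^ (c i * a i) * cnj u ^ (c i * b i)) = (u * cnj u) ^ (\<Sum>i=1..k. c i * b i)"
    by (simp add: prod.distrib power_mult_distrib flip: power_sum)
  also have "\<dots> = 1"
    using \<open>u * cnj u = 1\<close> by simp
  finally show ?thesis
    by (simp only: moment_invariant_def factor prod.distrib mult_1)
qed

end
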